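(* For all nonnegative integers $r_1,r_2$ and all integers $n\ge r_1+r_2+2$, \begin{align*} &\sum_{k=1}^{2n-1}\frac{B_k}{k!}\frac{B_{2n-k}}{(2n-k)!}\prod_{a=1}^{r_1}(k-a)\prod_{b=1}^{r_2}(2n-k-b) =\sum_{k=r_1+1}^{2n-r_2-1}\frac{B_k}{k!}\frac{B_{2n-k}}{(2n-k)!}\prod_{a=1}^{r_1}(k-a)\prod_{b=1}^{r_2}(2n-k-b)\\ &=-r_1!\,r_2!\left(\binom{2n-1}{r_1+r_2+1}+\mathop{\mathrm{Cyc}}_{r_1,r_2}(-1)^{r_2}\binom{2n-1}{r_1}\right)\frac{B_{2n}}{(2n)!}\\ &\quad-r_1!\,r_2!\,\mathop{\mathrm{Cyc}}_{r_1,r_2}(-1)^{r_1}\sum_{k=r_1+1}^{r_1+r_2+1}\binom{2n-1-k}{r_1+r_2+1-k}\binom{k-1}{r_1}\frac{B_k}{k!}\frac{B_{2n-k}}{(2n-k)!}. \end{align*}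
   Context: The Bernoulli numbers $B_j$ are defined by $\frac{t}{e^t-1}=\sum_{j\ge0}B_j\frac{t^j}{j!}$ (so $B_1=-1/2$). Empty products equal $1$. For any expression $f(r_1,r_2)$, $\mathop{\mathrm{Cyc}}_{r_1,r_2} f(r_1,r_2)=f(r_1,r_2)+f(r_2,r_1)$ (roles of $r_1,r_2$ interchanged everywhere, including summation limits). Binomial coefficients $\binom{a}{b}$ vanish for $b<0$ or $b>a$. *)

theory Defs
  imports "HOL-Computational_Algebra.Computational_Algebra"
begin

definition bernoulli :: "nat \<Rightarrow> real" where
  "bernoulli j = fact j * fps_nth (fps_X / (fps_exp 1 - 1)) j"

text \<open>
  The quotient of formal power series above is the honest one even though the denominator
  has constant term 0: the generating function identity holds after clearing denominators.
\<close>

lemma bernoulli_fps: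
  "Abs_fps (\<lambda>j. bernoulli j / fact j) * (fps_exp 1 - 1) = fps_X"
proof -
  have nz: "(fps_exp 1 - 1 :: real fps) \<noteq> 0"
  proof
    assume "(fps_exp 1 - 1 :: real fps) = 0"
    hence "fps_nth (fps_exp 1 - 1 :: real fps) 1 = 0" by simp
    thus False by simp
  qed
  have "subdegree (fps_exp 1 - 1 :: real fps) = 1"
    by (rule subdegreeI) auto
  hence "(fps_exp 1 - 1 :: real fps) dvd fps_X"
    using nz by (simp add: fps_dvd_iff)
  moreover have "Abs_fps (\<lambda>j. bernoulli j / fact j) = fps_X / (fps_exp 1 - 1)"
    by (rule fps_ext) (simp add: bernoulli_def)
  ultimately show ?thesis by simp
qed

lemma bernoulli_0: "bernoulli 0 = 1"
  using arg_cong[OF bernoulli_fps, of "\<lambda>f. fps_nth f 1"]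
  by (simp add: fps_mult_nth)

lemma bernoulli_1: "bernoulli 1 = - 1 / 2"
  using arg_cong[OF bernoulli_fps, of "\<lambda>f. fps_nth f 2"] bernoulli_0
  by (simp add: fps_mult_nth numeral_2_eq_2)

definition Cyc :: "(nat \<Rightarrow> nat \<Rightarrow> real) \<Rightarrow> nat \<Rightarrow> nat \<Rightarrow> real" where
  "Cyc f r\<^sub>1 r\<^sub>2 = f r\<^sub>1 r\<^sub>2 + f r\<^sub>2 r\<^sub>1"

end

theory Submission
  imports Defs
begin

text \<open>
  The function \<open>f(x) = 1/(e\<^sup>x - 1)\<close> satisfies \<open>f(x) f(y) = f(x+y) (1 + f(x) + f(y))\<close>.
  Its homogeneous part of even degree \<open>m - 2\<close>, with \<open>m = 2n\<close>, is a polynomial identity in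
  \<open>x, y\<close> whose coefficients are products of Bernoulli numbers. Substituting \<open>x = 1 + u\<close>,
  \<open>y = v - 1\<close>, so that \<open>x + y = u + v\<close>, and comparing coefficients of \<open>u^r\<^sub>1 v^r\<^sub>2\<close> gives the theorem:
  the sum on the left comes from \<open>f(x) f(y)\<close>, the short sums on the right from
  \<open>f(u+v) (f(x) + f(y))\<close>, and the multiples of \<open>B\<^bsub>2n\<^esub>\<close> from the poles \<open>1/x\<close>, \<open>1/y\<close>, \<open>1/(x+y)\<close>.

  Bivariate polynomials are elements of \<^typ>\<open>real poly poly\<close> with \<open>u\<close> the outer and \<open>v\<close> the
  inner variable, so \<open>1 + u\<close>, \<open>v - 1\<close> and \<open>u + v\<close> appear as \<open>[:1, 1:]\<close>, \<open>[:[:-1, 1:]:]\<close>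
  and \<open>[:[:0, 1:], 1:]\<close>.
\<close>

section \<open>The Bernoulli generating function and its addition formula\<close>

lemma bernoulli_fps_scaled:
  fixes x :: real
  shows "Abs_fps (\<lambda>k. bernoulli k / fact k * x ^ k) * (fps_exp x - 1) = fps_const x * fps_X"
proof -
  have "Abs_fps (\<lambda>j. bernoulli j / fact j) oo (fps_const x * fps_X)
          = Abs_fps (\<lambda>k. bernoulli k / fact k * x ^ k)"
    unfolding fps_compose_linear by (simp add: mult.commute)
  moreover have "(fps_exp 1 - 1) oo (fps_const x * fps_X) = fps_exp x - 1"
    by (simp add: fps_compose_sub_distrib)
  moreover have "(Abs_fps (\<lambda>j. bernoulli j / fact j) * (fps_exp 1 - 1)) oo (fps_const x * fps_X)
          = fps_const x * fps_X"
    by (simp add: bernoulli_fps)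
  ultimately show ?thesis
    by (simp add: fps_compose_mult_distrib)
qed

lemma fps_exp_minus_one_nz: "(fps_exp 1 - 1 :: real fps) \<noteq> 0"
proof
  assume "(fps_exp 1 - 1 :: real fps) = 0"
  hence "fps_nth (fps_exp 1 - 1 :: real fps) 1 = 0" by simp
  thus False by simp
qed

text \<open>With F(t) = t/(e^t - 1), multiplying by e^t - 1 shows F(-t) = t + F(t). Beyond the
  linear term F is therefore even.\<close>

lemma bernoulli_odd_eq_0:
  assumes "odd k" "k \<noteq> 1"
  shows "bernoulli k = 0"
proof -
  define F where "F = Abs_fps (\<lambda>j. bernoulli j / fact j)"
  define G where "G = Abs_fps (\<lambda>k. bernoulli k / fact k * (-1) ^ k)"
  have F: "F * (fps_exp 1 - 1) = fps_X" unfolding F_def by (rule bernoulli_fps)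
  have G: "G * (fps_exp (-1) - 1) = - fps_X"
    using bernoulli_fps_scaled[of "-1"] by (simp add: G_def fps_const_neg[symmetric] del: fps_const_neg)
  have E: "fps_exp (-1) * fps_exp 1 = (1 :: real fps)"
    by (simp add: fps_exp_add_mult[symmetric])
  have "G * (fps_exp 1 - 1) = G * (fps_exp 1 - fps_exp (-1) * fps_exp 1)"
    unfolding E ..
  also have "\<dots> = - (G * (fps_exp (-1) - 1)) * fps_exp 1"
    by (simp add: left_diff_distrib right_diff_distrib mult.assoc)
  also have "\<dots> = fps_X * (fps_exp 1 - 1) + fps_X"
    unfolding G by (simp add: algebra_simps)
  also have "\<dots> = (fps_X + F) * (fps_exp 1 - 1)" by (simp add: F distrib_right)
  finally have "G = fps_X + F" using fps_exp_minus_one_nz by simp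
  hence "fps_nth G k = fps_nth (fps_X + F) k" by simp
  thus ?thesis using assms by (simp add: F_def G_def)
qed

text \<open>In the formal variable t, \<open>F x\<close> stands for x t f(x t). The functional
  equation of f, multiplied by x y (x + y) t^2, becomes an identity without poles, so it also holds
  when x, y or x + y is 0.\<close>

lemma bernoulli_fps_addition:
  fixes x y :: real
  defines "F \<equiv> \<lambda>x. Abs_fps (\<lambda>k. bernoulli k / fact k * x ^ k)"
  shows "fps_const (x + y) * (F x * F y)
       = F (x + y) * (fps_const (x * y) * fps_X + fps_const x * F y + fps_const y * F x)"
proof -
  have F: "F x * (fps_exp x - 1) = fps_const x * fps_X" for x
    unfolding F_def by (rule bernoulli_fps_scaled)
  have E: "fps_exp (x + y) - 1 = (fps_exp x - 1) * (fps_exp y - 1) + (fps_exp x - 1) + (fps_exp y - 1)"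
    by (simp add: fps_exp_add_mult algebra_simps)
  \<comment> \<open>The extra \<open>fps_X\<close> completes (x + y) t, which can be traded for
    \<open>F (x + y) * (fps_exp (x + y) - 1)\<close>; it is cancelled at the end.\<close>
  have "fps_X * (fps_const (x + y) * (F x * F y)) = F x * F y * (F (x + y) * (fps_exp (x + y) - 1))"
    unfolding F by (simp add: mult_ac)
  also have "\<dots> = F (x + y) * ((F x * (fps_exp x - 1)) * (F y * (fps_exp y - 1))
      + (F x * (fps_exp x - 1)) * F y + (F y * (fps_exp y - 1)) * F x)"
    unfolding E by (simp add: algebra_simps)
  also have "\<dots> = fps_X * (F (x + y) * (fps_const (x * y) * fps_X + fps_const x * F y + fps_const y * F x))"
    unfolding F by (simp add: fps_const_mult[symmetric] algebra_simps del: fps_const_mult)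
  finally show ?thesis by simp
qed

lemma bernoulli_convolution_real:
  fixes x y :: real
  assumes "m \<ge> 3" "even m"
  defines "b \<equiv> \<lambda>k. bernoulli k / fact k"
  shows "(x + y) * (\<Sum>k\<le>m. b k * b (m - k) * x ^ k * y ^ (m - k))
       = (\<Sum>k\<le>m. b k * b (m - k) * (x + y) ^ k * (x * y ^ (m - k) + y * x ^ (m - k)))"
proof -
  define F where "F \<equiv> \<lambda>x. Abs_fps (\<lambda>k. b k * x ^ k)"
  \<comment> \<open>The only term of the addition formula that is not a product of two Bernoulli
    series beyond the factor \<open>F (x + y)\<close> is x y t. It contributes the coefficient of
    index m - 1, which is odd and at least 2.\<close>
  have "b (m - 1) = 0"
    using assms by (simp add: b_def bernoulli_odd_eq_0)
  hence 1: "fps_nth (F (x + y) * (fps_const (x * y) * fps_X)) m = 0"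
    using assms by (simp add: F_def mult.assoc[symmetric])
  have "fps_nth (fps_const (x + y) * (F x * F y)) m
      = fps_nth (F (x + y) * (fps_const (x * y) * fps_X)) m
        + fps_nth (F (x + y) * (fps_const x * F y + fps_const y * F x)) m"
      (is "_ = _ + ?t")
    using bernoulli_fps_addition[of x y]
    by (simp add: F_def b_def distrib_left add.assoc)
  hence "fps_nth (fps_const (x + y) * (F x * F y)) m = ?t"
    unfolding 1 by simp
  thus ?thesis unfolding fps_mult_nth[of "F (x + y)"] fps_mult_left_const_nth fps_add_nth
    by (simp add: fps_mult_nth F_def atMost_atLeast0 sum_distrib_left distrib_left mult_ac)
qed

section \<open>Transfer to bivariate polynomials and removal of the common factors\<close>

text \<open>As a polynomial over the integral domain of real polynomials, \<open>p\<close> has every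
  constant \<open>[:u:]\<close> as a root. That is infinitely many roots.\<close>

lemma bivariate_poly_eq_0:
  fixes p :: "real poly poly"
  assumes "\<And>u v. poly (poly p [:u:]) v = 0"
  shows "p = 0"
proof (rule ccontr)
  assume "p \<noteq> 0"
  hence "finite {z. poly p z = 0}" by (rule poly_roots_finite)
  moreover have "range (\<lambda>u. [:u:]) \<subseteq> {z. poly p z = 0}"
    using assms by (auto simp: poly_all_0_iff_0[symmetric])
  ultimately have "finite (range (\<lambda>u::real. [:u:]))" using finite_subset by blast
  hence "finite (UNIV :: real set)" by (rule finite_imageD) (auto intro: injI)
  thus False using infinite_UNIV_char_0 by blast
qed

lemma bernoulli_convolution_poly:
  fixes x y :: "real poly poly"
  assumes "m \<ge> 3" "even m"
  defines "b \<equiv> \<lambda>k. [:[:bernoulli k / fact k:]:]"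
  shows "(x + y) * (\<Sum>k\<le>m. b k * b (m - k) * x ^ k * y ^ (m - k))
       = (\<Sum>k\<le>m. b k * b (m - k) * (x + y) ^ k * (x * y ^ (m - k) + y * x ^ (m - k)))"
    (is "?l = ?r")
proof -
  have "?l - ?r = 0"
  proof (rule bivariate_poly_eq_0)
    fix u v
    show "poly (poly (?l - ?r) [:u:]) v = 0"
      using bernoulli_convolution_real[OF assms(1,2), of "poly (poly x [:u:]) v" "poly (poly y [:u:]) v"]
      by (simp add: poly_sum b_def mult.assoc)
  qed
  thus ?thesis by simp
qed

text \<open>
  \<open>Q1\<close>, \<open>Q2\<close>, \<open>Q3\<close> collect the contributions of the poles at \<open>x + y = 0\<close>, \<open>x = 0\<close>, \<open>y = 0\<close>.
\<close>

lemma bernoulli_convolution_quotient: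
  fixes x y :: "real poly poly"
  assumes m: "m \<ge> 3" "even m"
    and nz: "x \<noteq> 0" "y \<noteq> 0" "x + y \<noteq> 0"
    and Q1: "Q1 * (x + y) = x ^ (m - 1) + y ^ (m - 1)"
    and Q2: "Q2 * x = (x + y) ^ (m - 1) - y ^ (m - 1)"
    and Q3: "Q3 * y = (x + y) ^ (m - 1) - x ^ (m - 1)"
  defines "b \<equiv> \<lambda>k. [:[:bernoulli k / fact k:]:]"
  shows "(\<Sum>k=1..m-1. b k * b (m - k) * (x ^ (k - 1) * y ^ (m - k - 1)))
       = (\<Sum>k=1..m-1. b k * b (m - k) *
            ((x + y) ^ (k - 1) * x ^ (m - k - 1) + (x + y) ^ (k - 1) * y ^ (m - k - 1)))
         + b m * (Q1 + Q2 + Q3)" (is "?L = ?R + _")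
proof -
  define s where "s = x + y"
  have bd: "[:[:bernoulli k / fact k:]:] = b k" for k by (simp add: b_def)
  have b0: "b 0 = 1" by (simp add: b_def bernoulli_0 one_pCons)
  \<comment> \<open>The end terms are set apart because they lack a factor x, y or x + y; all inner
    terms are divisible by what is to be cancelled.\<close>
  have split: "(\<Sum>k\<le>m. g k) = g 0 + g m + (\<Sum>k=1..m-1. g k)" for g :: "nat \<Rightarrow> real poly poly"
  proof -
    have "{..m} = insert 0 (insert m {1..m-1})" using m by auto
    thus ?thesis using m by (simp add: add.assoc)
  qed
  have pw: "z ^ k = z * z ^ (k - 1)" if "k \<ge> 1" for z :: "real poly poly" and k
    using that by (cases k) auto
  have L: "(\<Sum>k=1..m-1. b k * b (m - k) * x ^ k * y ^ (m - k)) = x * y * ?L"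
    unfolding sum_distrib_left
  proof (rule sum.cong[OF refl])
    fix k assume "k \<in> {1..m-1}"
    hence "1 \<le> k" "1 \<le> m - k" by auto
    hence "x ^ k = x * x ^ (k - 1)" "y ^ (m - k) = y * y ^ (m - k - 1)"
      using pw by blast+
    thus "b k * b (m - k) * x ^ k * y ^ (m - k)
        = x * y * (b k * b (m - k) * (x ^ (k - 1) * y ^ (m - k - 1)))"
      by (simp only: mult_ac)
  qed
  have R: "(\<Sum>k=1..m-1. b k * b (m - k) * s ^ k * (x * y ^ (m - k) + y * x ^ (m - k)))
      = s * x * y * ?R"
    unfolding sum_distrib_left s_def[symmetric]
  proof (rule sum.cong[OF refl])
    fix k assume "k \<in> {1..m-1}"
    hence "1 \<le> k" "1 \<le> m - k" by auto
    hence e: "s ^ k = s * s ^ (k - 1)" "x ^ (m - k) = x * x ^ (m - k - 1)"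
        "y ^ (m - k) = y * y ^ (m - k - 1)"
      using pw by blast+
    show "b k * b (m - k) * s ^ k * (x * y ^ (m - k) + y * x ^ (m - k))
        = s * x * y * (b k * b (m - k) * (s ^ (k - 1) * x ^ (m - k - 1) + s ^ (k - 1) * y ^ (m - k - 1)))"
      unfolding e by (simp only: distrib_left mult_ac add_ac)
  qed
  have "s * (b m * y ^ m + b m * x ^ m + x * y * ?L)
      = b m * (x * y ^ m + y * x ^ m) + b m * s ^ m * (x + y) + s * x * y * ?R"
    using bernoulli_convolution_poly[OF m, of x y] L R
    by (simp add: split s_def[symmetric] bd b0)
  hence 1: "s * x * y * (?L - ?R)
      = b m * (x * y ^ m + y * x ^ m + s ^ m * s - s * x ^ m - s * y ^ m)"
    by (simp add: s_def algebra_simps)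
  have pm: "z ^ m = z * z ^ (m - 1)" for z :: "real poly poly"
    using m by (intro pw) auto
  \<comment> \<open>Each quotient meets its own divisor in s x y, which turns the three products
    into differences or sums of powers that match the end terms.\<close>
  have "s * x * y * (b m * (Q1 + Q2 + Q3))
      = b m * (x * y * (Q1 * s) + s * y * (Q2 * x) + s * x * (Q3 * y))"
    by (simp add: algebra_simps)
  also have "\<dots> = b m * (x * y ^ m + y * x ^ m + s ^ m * s - s * x ^ m - s * y ^ m)"
    unfolding Q1[folded s_def] Q2[folded s_def] Q3[folded s_def] pm
    by (simp add: s_def algebra_simps)
  finally have "s * x * y * (?L - ?R) = s * x * y * (b m * (Q1 + Q2 + Q3))"
    by (rule trans[OF 1 sym])
  hence "?L - ?R = b m * (Q1 + Q2 + Q3)" using nz by (simp add: s_def)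
  thus ?thesis by (simp add: algebra_simps)
qed

section \<open>Coefficients of the polynomials that occur after the substitution\<close>

text \<open>The coefficient ring is left general since both levels need it: real polynomials for the
  outer variable, reals for the inner one.\<close>

lemma coeff_monic_linear_power:
  fixes a :: "'a::comm_semiring_1"
  shows "coeff ([:a, 1:] ^ n) i = of_nat (n choose i) * a ^ (n - i)"
proof (cases "i \<le> n")
  case False
  have "degree ([:a, 1:] ^ n) \<le> degree [:a, 1:] * n" by (rule degree_power_le)
  also have "\<dots> < i" using False by simp
  finally show ?thesis using False by (simp add: coeff_eq_0 binomial_eq_0)
qed (simp add: coeff_linear_poly_power)

lemma coeff_X_power_mult:
  "coeff ([:0, 1:] ^ d * p) j = (if d \<le> j then coeff p (j - d) else (0::'a::comm_ring_1))"
  using coeff_monom_mult[of 1 d p j] by (simp add: monom_altdef)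

lemma coeff_of_nat_mult: "coeff (of_nat c * p) j = of_nat c * coeff p j"
  by (simp add: of_nat_poly)

lemma coeff_of_nat_poly: "coeff (of_nat c) j = (if j = 0 then of_nat c else 0)"
  by (simp add: of_nat_poly coeff_pCons split: nat.split)

lemma coeff_mult_const_power: "coeff (p * [:q:] ^ c) i = coeff p i * (q ^ c :: 'a::comm_semiring_1)"
  by (simp add: poly_const_pow mult.commute)

lemma coeff_xplus1_yminus1:
  "coeff (coeff ([:1, 1:] ^ d * [:[:-1, 1:]:] ^ c) i) j
     = (of_nat (d choose i) * of_nat (c choose j) * (-1) ^ (c - j) :: real)"
  by (simp only: coeff_mult_const_power coeff_monic_linear_power power_one mult_1_right
      coeff_of_nat_mult mult.assoc)

text \<open>The coefficient of u^i in (u + v)^d is binom(d, i) v^(d - i), so the power of v - 1 must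
  supply the remaining i + j - d powers of v.\<close>

lemma coeff_sum_power_yminus1:
  "coeff (coeff ([:[:0, 1:], 1:] ^ d * [:[:-1, 1:]:] ^ c) i) j
     = (if d \<le> i + j then of_nat (d choose i) * of_nat (c choose (i + j - d))
          * (-1) ^ (c - (i + j - d)) else (0 :: real))"
proof (cases "i \<le> d")
  case True
  have "j - (d - i) = i + j - d" "d - i \<le> j \<longleftrightarrow> d \<le> i + j" using True by auto
  thus ?thesis
    by (simp add: coeff_mult_const_power coeff_monic_linear_power coeff_of_nat_mult
        coeff_X_power_mult mult.assoc)
qed (simp add: coeff_mult_const_power coeff_monic_linear_power binomial_eq_0)

lemma coeff_sum_power_xplus1:
  "coeff (coeff ([:[:0, 1:], 1:] ^ d * [:1, 1:] ^ c) i) j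
     = (if d \<le> i + j then of_nat (d choose j) * of_nat (c choose (i + j - d)) else (0 :: real))"
proof -
  have "coeff (coeff ([:[:0, 1:], 1:] ^ d * [:1, 1:] ^ c) i) j
     = (\<Sum>l\<le>i. of_nat (d choose l) * of_nat (c choose (i - l)) * coeff ([:0, 1 :: real:] ^ (d - l)) j)"
    unfolding coeff_mult[of "[:[:0, 1:], 1:] ^ d"] coeff_sum coeff_monic_linear_power[of "[:0, 1:]"]
      coeff_monic_linear_power[of "1 :: real poly"] power_one mult_1_right
    by (rule sum.cong[OF refl])
      (simp only: coeff_of_nat_mult mult.assoc mult.commute[of "_ ^ _" "of_nat _"])
  \<comment> \<open>Only (u + v)^d contains v, hence v^j forces exactly d - j factors u from it, and
    a single summand of the convolution survives.\<close>
  also have "\<dots> = (\<Sum>l\<le>i. if l = d - j then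
        (if j \<le> d then of_nat (d choose j) * of_nat (c choose (i + j - d)) else 0) else 0)"
  proof (rule sum.cong[OF refl])
    fix l assume l: "l \<in> {..i}"
    have "coeff ([:0, 1 :: real:] ^ (d - l)) j = (if d - l = j then 1 else 0)"
      using coeff_X_power_mult[of "d - l" "1 :: real poly" j] by auto
    moreover have "of_nat (d choose l) = (0::real)" if "l > d" using that by simp
    moreover have "d choose (d - j) = d choose j" if "j \<le> d"
      using that by (rule binomial_symmetric[symmetric])
    ultimately show "of_nat (d choose l) * of_nat (c choose (i - l)) * coeff ([:0, 1 :: real:] ^ (d - l)) j
      = (if l = d - j then
        (if j \<le> d then of_nat (d choose j) * of_nat (c choose (i + j - d)) else 0) else 0)"
      using l by (cases "l \<le> d") auto
  qed
  also have "\<dots> = (if d \<le> i + j then of_nat (d choose j) * of_nat (c choose (i + j - d)) else 0)"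
    by (auto simp: le_diff_conv)
  finally show ?thesis .
qed

text \<open>(u + v)^M is homogeneous of degree M.\<close>

lemma coeff_sum_power_below:
  assumes "i + j < M"
  shows "coeff (coeff ([:[:0, 1 :: real:], 1:] ^ M) i) j = 0"
  using assms coeff_sum_power_xplus1[of M 0 i j] by simp

lemma coeff_xplus1_power:
  "coeff (coeff ([:1, 1:] ^ M) i) j = (if j = 0 then of_nat (M choose i) else (0 :: real))"
  by (simp add: coeff_monic_linear_power coeff_of_nat_poly)

lemma coeff_yminus1_power:
  "coeff (coeff ([:[:-1, 1:]:] ^ M) i) j
     = (if i = 0 then of_nat (M choose j) * (-1) ^ (M - j) else (0 :: real))"
  by (simp add: poly_const_pow coeff_monic_linear_power coeff_pCons split: nat.split)

text \<open>
  The coefficients of the three quotients are determined by the recurrences that arise from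
  multiplying with the divisor.
\<close>

lemma coeff_quotient_by_sum:
  fixes Q :: "real poly poly"
  assumes "odd M" and Q: "Q * [:[:0, 1:], 1:] = [:1, 1:] ^ M + [:[:-1, 1:]:] ^ M"
  shows "coeff (coeff Q i) j = (-1) ^ j * of_nat (M choose (i + j + 1))"
proof (induction i arbitrary: j)
  case 0
  have "coeff (coeff Q 0) j = coeff (coeff ([:1, 1:] ^ M + [:[:-1, 1:]:] ^ M) 0) (Suc j)"
    unfolding Q[symmetric] by simp
  also have "\<dots> = of_nat (M choose Suc j) * (-1) ^ (M - Suc j)"
    by (simp add: coeff_xplus1_power coeff_yminus1_power)
  also have "\<dots> = (-1) ^ j * of_nat (M choose Suc j)"
  proof (cases "Suc j \<le> M")
    case True
    hence "even (M - Suc j) = even j" using \<open>odd M\<close> by auto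
    thus ?thesis by (simp add: minus_one_power_iff)
  qed (simp add: binomial_eq_0)
  finally show ?case by simp
next
  case (Suc i)
  \<comment> \<open>The right-hand side has no mixed monomials, so a step along an antidiagonal only
    flips the sign; hence \<open>j\<close> is arbitrary in the induction.\<close>
  have "coeff (coeff Q (Suc i)) j + coeff (coeff Q i) (Suc j)
      = coeff (coeff ([:1, 1:] ^ M + [:[:-1, 1:]:] ^ M) (Suc i)) (Suc j)"
    unfolding Q[symmetric] by simp
  also have "\<dots> = 0"
    by (simp add: coeff_xplus1_power coeff_yminus1_power)
  finally show ?case using Suc.IH[of "Suc j"] by simp
qed

lemma coeff_quotient_by_x:
  fixes Q :: "real poly poly"
  assumes "odd M" and Q: "Q * [:1, 1:] = [:[:0, 1:], 1:] ^ M - [:[:-1, 1:]:] ^ M" and "i + j < M"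
  shows "coeff (coeff Q i) j = (-1) ^ (i + j) * of_nat (M choose j)"
  using assms(3)
proof (induction i)
  case 0
  have "coeff (coeff Q 0) j = coeff (coeff ([:[:0, 1:], 1:] ^ M - [:[:-1, 1:]:] ^ M) 0) j"
    unfolding Q[symmetric] by simp
  also have "\<dots> = - of_nat (M choose j) * (-1) ^ (M - j)"
    using 0 by (simp add: coeff_sum_power_below coeff_yminus1_power)
  moreover have "even (M - j) = odd j" using \<open>odd M\<close> 0 by auto
  ultimately show ?case by (simp add: minus_one_power_iff)
next
  case (Suc i)
  \<comment> \<open>Multiplication by 1 + u couples neighbours in i. Below total degree M the power
    of u + v is invisible, and the power of v - 1 only affects i = 0.\<close>
  have "coeff (coeff Q (Suc i)) j + coeff (coeff Q i) j
      = coeff (coeff ([:[:0, 1:], 1:] ^ M - [:[:-1, 1:]:] ^ M) (Suc i)) j"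
    unfolding Q[symmetric] by simp
  also have "\<dots> = 0"
    using Suc.prems by (simp add: coeff_sum_power_below coeff_yminus1_power)
  finally show ?case using Suc by simp
qed

lemma coeff_quotient_by_y:
  fixes Q :: "real poly poly"
  assumes Q: "Q * [:[:-1, 1:]:] = [:[:0, 1:], 1:] ^ M - [:1, 1:] ^ M" and "i + j < M"
  shows "coeff (coeff Q i) j = of_nat (M choose i)"
  using assms(2)
proof (induction j)
  case 0
  have "- coeff (coeff Q i) 0 = coeff (coeff ([:[:0, 1:], 1:] ^ M - [:1, 1:] ^ M) i) 0"
    unfolding Q[symmetric] by simp
  also have "\<dots> = - of_nat (M choose i)"
    using 0 by (simp add: coeff_sum_power_below coeff_xplus1_power)
  finally show ?case by simp
next
  case (Suc j)
  \<comment> \<open>Multiplication by v - 1 couples neighbours in j, and below total degree M the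
    coefficients are constant in j.\<close>
  have "coeff (coeff Q i) j - coeff (coeff Q i) (Suc j)
      = coeff (coeff ([:[:0, 1:], 1:] ^ M - [:1, 1:] ^ M) i) (Suc j)"
    unfolding Q[symmetric] by simp
  also have "\<dots> = 0"
    using Suc.prems by (simp add: coeff_sum_power_below coeff_xplus1_power)
  finally show ?case using Suc by simp
qed

section \<open>Comparison of coefficients and the final formula\<close>

lemma bernoulli_convolution_binomial:
  assumes m: "even m" "m \<ge> 3" "r + s + 2 \<le> m"
  defines "b \<equiv> \<lambda>k. bernoulli k / fact k"
  shows "(\<Sum>k=1..m-1. b k * b (m - k) *
            (real ((k - 1) choose r) * real ((m - k - 1) choose s) * (-1) ^ (m - k - 1 - s)))
       = (\<Sum>k=1..m-1. b k * b (m - k) * (if k - 1 \<le> r + s then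
             real ((k - 1) choose s) * real ((m - k - 1) choose (r + s - (k - 1)))
           + (-1) ^ (r + s) * (real ((k - 1) choose r) * real ((m - k - 1) choose (r + s - (k - 1))))
           else 0))
         + b m * ((-1) ^ s * real ((m - 1) choose (r + s + 1))
           + (-1) ^ (r + s) * real ((m - 1) choose s) + real ((m - 1) choose r))"
proof -
  define x y :: "real poly poly" where "x = [:1, 1:]" and "y = [:[:-1, 1:]:]"
  have xy: "x + y = [:[:0, 1:], 1:]" by (simp add: x_def y_def one_pCons)
  define M where "M = m - 1"
  have M: "odd M" "r + s < M" using m by (auto simp: M_def)
  \<comment> \<open>The quotients are geometric sums. For \<open>Q1\<close> the odd exponent lets
    x^M + y^M be read as x^M - (-y)^M, divisible by x + y.\<close>
  define Q1 where "Q1 = (\<Sum>i<M. (-y) ^ (M - Suc i) * x ^ i)"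
  define Q2 where "Q2 = (\<Sum>i<M. y ^ (M - Suc i) * (x + y) ^ i)"
  define Q3 where "Q3 = (\<Sum>i<M. x ^ (M - Suc i) * (x + y) ^ i)"
  have Q1: "Q1 * (x + y) = x ^ M + y ^ M"
    using power_diff_sumr2[of x M "-y"] M by (simp add: Q1_def mult.commute)
  have Q2: "Q2 * x = (x + y) ^ M - y ^ M"
    using power_diff_sumr2[of "x + y" M y] by (simp add: Q2_def mult.commute)
  have Q3: "Q3 * y = (x + y) ^ M - x ^ M"
    using power_diff_sumr2[of "x + y" M x] by (simp add: Q3_def mult.commute)
  have cf: "coeff (coeff (\<Sum>k=1..m-1. [:[:b k:]:] * [:[:b (m - k):]:] * g k) r) s
      = (\<Sum>k=1..m-1. b k * b (m - k) * coeff (coeff (g k) r) s)" for g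
    by (simp add: coeff_sum mult.assoc)
  have nz: "x \<noteq> 0" "y \<noteq> 0" "x + y \<noteq> 0"
    unfolding xy by (simp_all add: x_def y_def)
  have "(\<Sum>k=1..m-1. b k * b (m - k) * coeff (coeff (x ^ (k - 1) * y ^ (m - k - 1)) r) s)
      = (\<Sum>k=1..m-1. b k * b (m - k) * coeff (coeff
            ((x + y) ^ (k - 1) * x ^ (m - k - 1) + (x + y) ^ (k - 1) * y ^ (m - k - 1)) r) s)
         + coeff (coeff ([:[:b m:]:] * (Q1 + Q2 + Q3)) r) s"
    using arg_cong[OF bernoulli_convolution_quotient[OF m(2,1) nz Q1[unfolded M_def]
        Q2[unfolded M_def] Q3[unfolded M_def]], of "\<lambda>p. coeff (coeff p r) s"]
    unfolding coeff_add[of "sum _ _"] coeff_add[of "coeff (sum _ _) _"] cf[unfolded b_def] b_def .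
  also have "coeff (coeff ([:[:b m:]:] * (Q1 + Q2 + Q3)) r) s
      = b m * (coeff (coeff Q1 r) s + coeff (coeff Q2 r) s + coeff (coeff Q3 r) s)"
    by simp
  also have "coeff (coeff Q1 r) s = (-1) ^ s * real (M choose (r + s + 1))"
    using M Q1[unfolded xy, unfolded x_def y_def] by (intro coeff_quotient_by_sum)
  also have "coeff (coeff Q2 r) s = (-1) ^ (r + s) * real (M choose s)"
    using M Q2[unfolded xy, unfolded x_def y_def] by (intro coeff_quotient_by_x)
  also have "coeff (coeff Q3 r) s = real (M choose r)"
    using M Q3[unfolded xy, unfolded x_def y_def] by (intro coeff_quotient_by_y)
  also have "(\<Sum>k=1..m-1. b k * b (m - k) * coeff (coeff
            ((x + y) ^ (k - 1) * x ^ (m - k - 1) + (x + y) ^ (k - 1) * y ^ (m - k - 1)) r) s)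
      = (\<Sum>k=1..m-1. b k * b (m - k) * (if k - 1 \<le> r + s then
             real ((k - 1) choose s) * real ((m - k - 1) choose (r + s - (k - 1)))
           + (-1) ^ (r + s) * (real ((k - 1) choose r) * real ((m - k - 1) choose (r + s - (k - 1))))
           else 0))"
  proof (rule sum.cong[OF refl])
    fix k assume k: "k \<in> {1..m-1}"
    \<comment> \<open>The index k cancels in the exponent, leaving m - 2 - (r + s), whose parity is
      that of r + s.\<close>
    have "(-1) ^ (m - k - 1 - (r + s - (k - 1))) = ((-1) ^ (r + s) :: real)" if "k - 1 \<le> r + s"
    proof -
      have "m - k - 1 - (r + s - (k - 1)) = m - 2 - (r + s)" using that k m by auto
      moreover have "even (m - 2 - (r + s)) = even (r + s)" using m by auto
      ultimately show ?thesis by (simp add: minus_one_power_iff)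
    qed
    thus "b k * b (m - k) * coeff (coeff
            ((x + y) ^ (k - 1) * x ^ (m - k - 1) + (x + y) ^ (k - 1) * y ^ (m - k - 1)) r) s
      = b k * b (m - k) * (if k - 1 \<le> r + s then
             real ((k - 1) choose s) * real ((m - k - 1) choose (r + s - (k - 1)))
           + (-1) ^ (r + s) * (real ((k - 1) choose r) * real ((m - k - 1) choose (r + s - (k - 1))))
           else 0)"
      unfolding coeff_add xy unfolding x_def y_def coeff_sum_power_xplus1 coeff_sum_power_yminus1
      by auto
  qed
  finally show ?thesis
    unfolding x_def y_def coeff_xplus1_yminus1 M_def .
qed

text \<open>The product is the falling factorial of k - 1 of length r; it vanishes for 1 \<le> k
  \<le> r just as the binomial does.\<close>

lemma prod_diff_eq_fact_mult_binomial:
  assumes "k \<ge> 1"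
  shows "(\<Prod>a=1..r. real k - real a) = fact r * real ((k - 1) choose r)"
proof -
  have "(\<Prod>a=1..r. real k - real a) = (\<Prod>i=0..<r. real (k - 1) - real i)"
    using assms by (intro prod.reindex_bij_witness[of _ Suc "\<lambda>a. a - 1"]) (auto simp: of_nat_diff)
  thus ?thesis by (simp add: binomial_gbinomial gbinomial_prod_rev)
qed

theorem theorem2p4:
  fixes r\<^sub>1 r\<^sub>2 n :: nat
  assumes "n \<ge> r\<^sub>1 + r\<^sub>2 + 2"
  shows "(\<Sum>k = 1..2*n-1. bernoulli k / fact k * (bernoulli (2*n-k) / fact (2*n-k))
            * (\<Prod>a = 1..r\<^sub>1. real k - real a) * (\<Prod>b = 1..r\<^sub>2. real (2*n) - real k - real b))
       = (\<Sum>k = r\<^sub>1+1..2*n-r\<^sub>2-1. bernoulli k / fact k * (bernoulli (2*n-k) / fact (2*n-k))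
            * (\<Prod>a = 1..r\<^sub>1. real k - real a) * (\<Prod>b = 1..r\<^sub>2. real (2*n) - real k - real b))
     \<and> (\<Sum>k = r\<^sub>1+1..2*n-r\<^sub>2-1. bernoulli k / fact k * (bernoulli (2*n-k) / fact (2*n-k))
            * (\<Prod>a = 1..r\<^sub>1. real k - real a) * (\<Prod>b = 1..r\<^sub>2. real (2*n) - real k - real b))
       = - (fact r\<^sub>1 * fact r\<^sub>2
            * (real ((2*n-1) choose (r\<^sub>1+r\<^sub>2+1))
               + Cyc (\<lambda>s\<^sub>1 s\<^sub>2. (-1) ^ s\<^sub>2 * real ((2*n-1) choose s\<^sub>1)) r\<^sub>1 r\<^sub>2)
            * (bernoulli (2*n) / fact (2*n)))
         - fact r\<^sub>1 * fact r\<^sub>2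
            * Cyc (\<lambda>s\<^sub>1 s\<^sub>2. (-1) ^ s\<^sub>1 *
                (\<Sum>k = s\<^sub>1+1..s\<^sub>1+s\<^sub>2+1.
                   real ((2*n-1-k) choose (s\<^sub>1+s\<^sub>2+1-k)) * real ((k-1) choose s\<^sub>1)
                   * (bernoulli k / fact k) * (bernoulli (2*n-k) / fact (2*n-k)))) r\<^sub>1 r\<^sub>2"
    (is "?S = ?S' \<and> ?S' = ?T")
proof -
  define b where "b k = bernoulli k / fact k" for k
  define m where "m = 2 * n"
  have m: "even m" "m \<ge> 3" "r\<^sub>1 + r\<^sub>2 + 2 \<le> m" using assms by (auto simp: m_def)
  define S0 where "S0 = (\<Sum>k=1..m-1. b k * b (m - k) *
      (real ((k - 1) choose r\<^sub>1) * real ((m - k - 1) choose r\<^sub>2)))"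
  have P1: "(\<Prod>a = 1..r\<^sub>1. real k - real a) = fact r\<^sub>1 * real ((k - 1) choose r\<^sub>1)"
    and P2: "(\<Prod>b = 1..r\<^sub>2. real (2*n) - real k - real b) = fact r\<^sub>2 * real ((m - k - 1) choose r\<^sub>2)"
    if "k \<in> {1..m-1}" for k
    using that prod_diff_eq_fact_mult_binomial[of k r\<^sub>1] prod_diff_eq_fact_mult_binomial[of "m - k" r\<^sub>2]
    by (auto simp: m_def of_nat_diff)
  \<comment> \<open>Each index dropped from the range makes one of the two products contain the
    factor 0.\<close>
  have S_eq: "?S = ?S'"
  proof (rule sum.mono_neutral_right)
    show "\<forall>k\<in>{1..2*n-1} - {r\<^sub>1+1..2*n-r\<^sub>2-1}.
        bernoulli k / fact k * (bernoulli (2*n-k) / fact (2*n-k))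
            * (\<Prod>a = 1..r\<^sub>1. real k - real a) * (\<Prod>b = 1..r\<^sub>2. real (2*n) - real k - real b) = 0"
    proof
      fix k assume k: "k \<in> {1..2*n-1} - {r\<^sub>1+1..2*n-r\<^sub>2-1}"
      hence "k - 1 < r\<^sub>1 \<or> m - k - 1 < r\<^sub>2" by (auto simp: m_def)
      hence "((k - 1) choose r\<^sub>1) = 0 \<or> ((m - k - 1) choose r\<^sub>2) = 0" by auto
      moreover have "k \<in> {1..m-1}" using k by (simp add: m_def)
      ultimately show "bernoulli k / fact k * (bernoulli (2*n-k) / fact (2*n-k))
            * (\<Prod>a = 1..r\<^sub>1. real k - real a) * (\<Prod>b = 1..r\<^sub>2. real (2*n) - real k - real b) = 0"
        using P1[of k] P2[of k] by auto
    qed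
  qed auto
  have S0: "?S = fact r\<^sub>1 * fact r\<^sub>2 * S0"
    unfolding S0_def sum_distrib_left m_def[symmetric] b_def[symmetric]
    by (rule sum.cong[OF refl]) (simp only: P1 P2[unfolded m_def[symmetric]] mult_ac)
  \<comment> \<open>\<open>H\<close> is the short sum under \<open>Cyc\<close> without its sign. The
    condition \<open>k - 1 \<le> i + j\<close> bounds its range above, and the vanishing of binom(k
    - 1, i) bounds it below.\<close>
  define H where "H i j = (\<Sum>k = i+1..i+j+1. real ((m-1-k) choose (i+j+1-k)) * real ((k-1) choose i)
                   * b k * b (m-k))" for i j
  have H: "(\<Sum>k=1..m-1. b k * b (m - k) * (if k - 1 \<le> i + j then
             real ((k - 1) choose i) * real ((m - k - 1) choose (i + j - (k - 1))) else 0)) = H i j"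
    if "i + j + 2 \<le> m" for i j
    unfolding H_def
  proof (rule sum.mono_neutral_cong_right)
    show "{i + 1..i + j + 1} \<subseteq> {1..m - 1}" using that by auto
    show "\<forall>k\<in>{1..m - 1} - {i + 1..i + j + 1}. b k * b (m - k) * (if k - 1 \<le> i + j then
             real ((k - 1) choose i) * real ((m - k - 1) choose (i + j - (k - 1))) else 0) = 0"
      by auto
    show "b k * b (m - k) * (if k - 1 \<le> i + j then
             real ((k - 1) choose i) * real ((m - k - 1) choose (i + j - (k - 1))) else 0)
        = real ((m-1-k) choose (i+j+1-k)) * real ((k-1) choose i) * b k * b (m-k)"
      if "k \<in> {i + 1..i + j + 1}" for k
    proof -
      have "m - k - 1 = m - 1 - k" "i + j - (k - 1) = i + j + 1 - k" "k - 1 \<le> i + j" using that by auto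
      thus ?thesis by (simp only: if_True mult_ac)
    qed
  qed auto
  \<comment> \<open>As \<open>m\<close> is even, only even \<open>k\<close> contribute, so the sign does not depend on \<open>k\<close>.\<close>
  have "- ((-1) ^ r\<^sub>2) * S0 = (\<Sum>k=1..m-1. b k * b (m - k) * (real ((k - 1) choose r\<^sub>1)
      * real ((m - k - 1) choose r\<^sub>2) * (-1) ^ (m - k - 1 - r\<^sub>2)))"
    unfolding S0_def sum_distrib_left
  proof (rule sum.cong[OF refl])
    fix k assume k: "k \<in> {1..m-1}"
    consider "odd k" | "even k" "m - k - 1 < r\<^sub>2" | "even k" "r\<^sub>2 \<le> m - k - 1" by linarith
    thus "- ((-1) ^ r\<^sub>2) * (b k * b (m - k) * (real ((k - 1) choose r\<^sub>1) * real ((m - k - 1) choose r\<^sub>2)))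
      = b k * b (m - k) * (real ((k - 1) choose r\<^sub>1)
          * real ((m - k - 1) choose r\<^sub>2) * (-1) ^ (m - k - 1 - r\<^sub>2))"
    proof cases
      case 1
      have "b k * b (m - k) = 0"
      proof (cases "k = 1")
        \<comment> \<open>B_1 is nonzero, but its partner has the odd index m - 1 > 1.\<close>
        case True
        hence "bernoulli (m - k) = 0" using m by (intro bernoulli_odd_eq_0) auto
        thus ?thesis by (simp add: b_def)
      next
        case False
        thus ?thesis using 1 by (simp add: b_def bernoulli_odd_eq_0)
      qed
      thus ?thesis by auto
    next
      case 3
      hence "even (m - k - 1 - r\<^sub>2) = odd r\<^sub>2" using m k by auto
      thus ?thesis by (simp add: minus_one_power_iff)
    qed (simp add: binomial_eq_0)
  qed
  also have "\<dots> = H r\<^sub>2 r\<^sub>1 + (-1) ^ (r\<^sub>1 + r\<^sub>2) * H r\<^sub>1 r\<^sub>2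
      + b m * ((-1) ^ r\<^sub>2 * real ((m - 1) choose (r\<^sub>1 + r\<^sub>2 + 1))
           + (-1) ^ (r\<^sub>1 + r\<^sub>2) * real ((m - 1) choose r\<^sub>2) + real ((m - 1) choose r\<^sub>1))"
  proof -
    have m': "r\<^sub>2 + r\<^sub>1 + 2 \<le> m" using m by simp
    have "(\<Sum>k=1..m-1. b k * b (m - k) * (if k - 1 \<le> r\<^sub>1 + r\<^sub>2 then
             real ((k - 1) choose r\<^sub>2) * real ((m - k - 1) choose (r\<^sub>1 + r\<^sub>2 - (k - 1)))
           + (-1) ^ (r\<^sub>1 + r\<^sub>2)
             * (real ((k - 1) choose r\<^sub>1) * real ((m - k - 1) choose (r\<^sub>1 + r\<^sub>2 - (k - 1))))
           else 0)) = H r\<^sub>2 r\<^sub>1 + (-1) ^ (r\<^sub>1 + r\<^sub>2) * H r\<^sub>1 r\<^sub>2"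
      unfolding H[OF m', symmetric] H[OF m(3), symmetric] sum_distrib_left sum.distrib[symmetric]
      by (rule sum.cong[OF refl]) (simp add: add.commute[of r\<^sub>2 r\<^sub>1] distrib_left)
    thus ?thesis
      unfolding bernoulli_convolution_binomial[OF m, folded b_def] by simp
  qed
  \<comment> \<open>Multiplying by the sign isolates -\<open>S0\<close> and turns (-1)^(r1 + r2)
    into (-1)^r1, as the cyclic form requires.\<close>
  finally have "(-1) ^ r\<^sub>2 * (- ((-1) ^ r\<^sub>2) * S0) = (-1) ^ r\<^sub>2 * (H r\<^sub>2 r\<^sub>1 + (-1) ^ (r\<^sub>1 + r\<^sub>2) * H r\<^sub>1 r\<^sub>2
      + b m * ((-1) ^ r\<^sub>2 * real ((m - 1) choose (r\<^sub>1 + r\<^sub>2 + 1))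
           + (-1) ^ (r\<^sub>1 + r\<^sub>2) * real ((m - 1) choose r\<^sub>2) + real ((m - 1) choose r\<^sub>1)))"
    by simp
  hence S0_val: "S0 = - (real ((m - 1) choose (r\<^sub>1 + r\<^sub>2 + 1)) + ((-1) ^ r\<^sub>2 * real ((m - 1) choose r\<^sub>1)
        + (-1) ^ r\<^sub>1 * real ((m - 1) choose r\<^sub>2))) * b m
      - ((-1) ^ r\<^sub>1 * H r\<^sub>1 r\<^sub>2 + (-1) ^ r\<^sub>2 * H r\<^sub>2 r\<^sub>1)"
    by (cases "even r\<^sub>1"; cases "even r\<^sub>2") (simp_all add: algebra_simps)
  have "fact r\<^sub>1 * fact r\<^sub>2 * S0 = ?T"
    unfolding S0_val Cyc_def m_def[symmetric] b_def[symmetric] H_def[symmetric]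
    by (simp add: algebra_simps)
  hence "?S' = ?T" using S0 unfolding S_eq by (rule trans[rotated])
  with S_eq show ?thesis by (rule conjI)
qed

end
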